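(* Let $R$ be a ring. Then the following statements are equivalent. (i) $R$ is an mp-ring. (ii) For all $a,b\in R$, if $ab=0$, then there exists $n\geq 1$ such that $\mathrm{Ann}(a^{n})+\mathrm{Ann}(b^{n})=R$. (iii) Every minimal prime ideal of $R$ is an N-pure ideal. (iv) For every minimal prime ideal $\mathfrak{p}$ of $R$, $\mathrm{Ker}\,\pi_{\mathfrak{p}}$ is an N-pure ideal. (v) For every prime ideal $\mathfrak{p}$ of $R$, $\mathrm{Ker}\,\pi_{\mathfrak{p}}$ is an N-pure ideal.
   Context: All rings are commutative with identity. $\mathfrak{N}$ denotes the nil-radical of $R$, and $\mathrm{Ann}(a)=\{r\in R: ra=0\}$. For a prime ideal $\mathfrak{p}$, $\pi_{\mathfrak{p}}:R\to R_{\mathfrak{p}}$ is the canonical localization map, so $\mathrm{Ker}\,\pi_{\mathfrak{p}}=\{a\in R:\exists s\in R\setminus\mathfrak{p},\ sa=0\}$. An ideal $I$ of $R$ is called N-pure if for every $a\in I$ there exists $b\in I$ such that $a(1-b)\in\mathfrak{N}$. A ring $R$ is an mp-ring if each prime ideal of $R$ contains a unique minimal prime ideal of $R$. *)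

theory Defs
  imports "HOL-Algebra.Ideal" "HOL-Algebra.RingHom"
begin

definition nilradical :: "('a, 'b) ring_scheme \<Rightarrow> 'a set" where
  "nilradical R = {x \<in> carrier R. \<exists>n::nat. x [^]\<^bsub>R\<^esub> n = \<zero>\<^bsub>R\<^esub>}"

definition Ann :: "('a, 'b) ring_scheme \<Rightarrow> 'a \<Rightarrow> 'a set" where
  "Ann R a = {r \<in> carrier R. r \<otimes>\<^bsub>R\<^esub> a = \<zero>\<^bsub>R\<^esub>}"

definition N_pure_ideal :: "'a set \<Rightarrow> ('a, 'b) ring_scheme \<Rightarrow> bool" where
  "N_pure_ideal I R \<longleftrightarrow>
     ideal I R \<and> (\<forall>a\<in>I. \<exists>b\<in>I. a \<otimes>\<^bsub>R\<^esub> (\<one>\<^bsub>R\<^esub> \<ominus>\<^bsub>R\<^esub> b) \<in> nilradical R)"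

definition minimal_primeideal :: "'a set \<Rightarrow> ('a, 'b) ring_scheme \<Rightarrow> bool" where
  "minimal_primeideal P R \<longleftrightarrow>
     primeideal P R \<and> (\<forall>Q. primeideal Q R \<and> Q \<subseteq> P \<longrightarrow> Q = P)"

definition mp_ring :: "('a, 'b) ring_scheme \<Rightarrow> bool" where
  "mp_ring R \<longleftrightarrow>
     cring R \<and> (\<forall>P. primeideal P R \<longrightarrow> (\<exists>!Q. minimal_primeideal Q R \<and> Q \<subseteq> P))"

text \<open>
  The fraction \<open>a / s\<close> of the localization at \<open>P\<close> is the set of all pairs \<open>(b, t)\<close> with \<open>t\<close>
  outside \<open>P\<close> and \<open>u t a = u s b\<close> for some \<open>u\<close> outside \<open>P\<close>.
\<close>

definition loc_frac :: "('a, 'b) ring_scheme \<Rightarrow> 'a set \<Rightarrow> 'a \<Rightarrow> 'a \<Rightarrow> ('a \<times> 'a) set" where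
  "loc_frac R P a s = {(b, t). b \<in> carrier R \<and> t \<in> carrier R - P \<and>
     (\<exists>u \<in> carrier R - P. u \<otimes>\<^bsub>R\<^esub> (t \<otimes>\<^bsub>R\<^esub> a) = u \<otimes>\<^bsub>R\<^esub> (s \<otimes>\<^bsub>R\<^esub> b))}"

text \<open>
  The operations on classes take the union over all representatives; when \<open>P\<close> is prime, all
  members of that union coincide (lemmas \<open>localization_mult\<close> and \<open>localization_add\<close>).
\<close>

definition localization :: "('a, 'b) ring_scheme \<Rightarrow> 'a set \<Rightarrow> ('a \<times> 'a) set ring" where
  "localization R P =
     \<lparr> carrier = {loc_frac R P a s | a s. a \<in> carrier R \<and> s \<in> carrier R - P},
       mult = (\<lambda>X Y. \<Union>(a, s)\<in>X. \<Union>(b, t)\<in>Y. loc_frac R P (a \<otimes>\<^bsub>R\<^esub> b) (s \<otimes>\<^bsub>R\<^esub> t)),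
       one = loc_frac R P \<one>\<^bsub>R\<^esub> \<one>\<^bsub>R\<^esub>,
       zero = loc_frac R P \<zero>\<^bsub>R\<^esub> \<one>\<^bsub>R\<^esub>,
       add = (\<lambda>X Y. \<Union>(a, s)\<in>X. \<Union>(b, t)\<in>Y.
                loc_frac R P (t \<otimes>\<^bsub>R\<^esub> a \<oplus>\<^bsub>R\<^esub> s \<otimes>\<^bsub>R\<^esub> b) (s \<otimes>\<^bsub>R\<^esub> t)) \<rparr>"

definition localization_map :: "('a, 'b) ring_scheme \<Rightarrow> 'a set \<Rightarrow> 'a \<Rightarrow> ('a \<times> 'a) set" where
  "localization_map R P a = loc_frac R P a \<one>\<^bsub>R\<^esub>"

lemma UN_pairs_const:
  assumes "(a, s) \<in> X" "(b, t) \<in> Y"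
    "\<And>a s b t. (a, s) \<in> X \<Longrightarrow> (b, t) \<in> Y \<Longrightarrow> f a s b t = C"
  shows "(\<Union>(a, s)\<in>X. \<Union>(b, t)\<in>Y. f a s b t) = C"
  using assms by fastforce

context primeideal
begin

lemma compl_mult: "s \<in> carrier R - I \<Longrightarrow> t \<in> carrier R - I \<Longrightarrow> s \<otimes> t \<in> carrier R - I"
  using I_prime by auto

lemma compl_one: "\<one> \<in> carrier R - I"
  using I_notcarr one_imp_carrier by auto

lemma loc_frac_refl: "a \<in> carrier R \<Longrightarrow> s \<in> carrier R - I \<Longrightarrow> (a, s) \<in> loc_frac R I a s"
  unfolding loc_frac_def using compl_one by auto

lemma loc_frac_sym: "(b, t) \<in> loc_frac R I a s \<Longrightarrow> a \<in> carrier R \<Longrightarrow> s \<in> carrier R - I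
    \<Longrightarrow> (a, s) \<in> loc_frac R I b t"
  unfolding loc_frac_def by (auto dest: sym)

lemma loc_frac_trans:
  assumes "(b, t) \<in> loc_frac R I a s" "(c, r) \<in> loc_frac R I b t" "a \<in> carrier R" "s \<in> carrier R - I"
  shows "(c, r) \<in> loc_frac R I a s"
proof -
  from assms obtain u v where
    c: "a \<in> carrier R" "s \<in> carrier R" "b \<in> carrier R" "t \<in> carrier R" "c \<in> carrier R"
      "r \<in> carrier R" "u \<in> carrier R" "v \<in> carrier R"
    and n: "t \<notin> I" "u \<notin> I" "v \<notin> I" "r \<notin> I"
    and 1: "u \<otimes> (t \<otimes> a) = u \<otimes> (s \<otimes> b)" and 2: "v \<otimes> (r \<otimes> b) = v \<otimes> (t \<otimes> c)"
    unfolding loc_frac_def by auto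
  have "(u \<otimes> v \<otimes> t) \<otimes> (r \<otimes> a) = (v \<otimes> r) \<otimes> (u \<otimes> (t \<otimes> a))"
    using c by (simp add: m_ac)
  also have "\<dots> = (u \<otimes> s) \<otimes> (v \<otimes> (r \<otimes> b))"
    unfolding 1 using c by (simp add: m_ac)
  also have "\<dots> = (u \<otimes> v \<otimes> t) \<otimes> (s \<otimes> c)"
    unfolding 2 using c by (simp add: m_ac)
  finally have "(u \<otimes> v \<otimes> t) \<otimes> (r \<otimes> a) = (u \<otimes> v \<otimes> t) \<otimes> (s \<otimes> c)" .
  moreover have "u \<otimes> v \<otimes> t \<in> carrier R - I" using c n compl_mult by auto
  ultimately show ?thesis unfolding loc_frac_def using c n by blast
qed

lemma loc_frac_eq_iff:
  assumes "a \<in> carrier R" "s \<in> carrier R - I" "b \<in> carrier R" "t \<in> carrier R - I"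
  shows "loc_frac R I a s = loc_frac R I b t \<longleftrightarrow>
    (\<exists>u \<in> carrier R - I. u \<otimes> (t \<otimes> a) = u \<otimes> (s \<otimes> b))"
proof -
  have "loc_frac R I a s = loc_frac R I b t \<longleftrightarrow> (b, t) \<in> loc_frac R I a s"
  proof
    assume "loc_frac R I a s = loc_frac R I b t"
    then show "(b, t) \<in> loc_frac R I a s" using loc_frac_refl assms by auto
  next
    assume 1: "(b, t) \<in> loc_frac R I a s"
    have 2: "(a, s) \<in> loc_frac R I b t" using loc_frac_sym[OF 1 assms(1,2)] .
    show "loc_frac R I a s = loc_frac R I b t"
    proof
      show "loc_frac R I a s \<subseteq> loc_frac R I b t"
        by (rule subrelI) (rule loc_frac_trans[OF 2 _ assms(3,4)])
      show "loc_frac R I b t \<subseteq> loc_frac R I a s"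
        by (rule subrelI) (rule loc_frac_trans[OF 1 _ assms(1,2)])
    qed
  qed
  then show ?thesis using assms by (simp add: loc_frac_def)
qed

lemma loc_frac_eqD:
  assumes "(b, t) \<in> loc_frac R I a s" "a \<in> carrier R" "s \<in> carrier R - I"
  shows "b \<in> carrier R" "t \<in> carrier R - I" "loc_frac R I a s = loc_frac R I b t"
proof -
  show *: "b \<in> carrier R" "t \<in> carrier R - I" using assms by (auto simp: loc_frac_def)
  show "loc_frac R I a s = loc_frac R I b t"
    using assms(1) loc_frac_eq_iff[OF assms(2,3) *] by (simp add: loc_frac_def)
qed

lemma loc_frac_mult_cong:
  assumes "a \<in> carrier R" "s \<in> carrier R - I" "a' \<in> carrier R" "s' \<in> carrier R - I"
    "b \<in> carrier R" "t \<in> carrier R - I" "b' \<in> carrier R" "t' \<in> carrier R - I"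
    "loc_frac R I a s = loc_frac R I a' s'" "loc_frac R I b t = loc_frac R I b' t'"
  shows "loc_frac R I (a \<otimes> b) (s \<otimes> t) = loc_frac R I (a' \<otimes> b') (s' \<otimes> t')"
proof -
  obtain u v where uv: "u \<in> carrier R - I" "v \<in> carrier R - I"
    and 1: "u \<otimes> (s' \<otimes> a) = u \<otimes> (s \<otimes> a')" and 2: "v \<otimes> (t' \<otimes> b) = v \<otimes> (t \<otimes> b')"
    using assms(9,10) loc_frac_eq_iff[OF assms(1-4)] loc_frac_eq_iff[OF assms(5-8)] by blast
  have c: "a \<in> carrier R" "s \<in> carrier R" "a' \<in> carrier R" "s' \<in> carrier R" "b \<in> carrier R"
    "t \<in> carrier R" "b' \<in> carrier R" "t' \<in> carrier R" "u \<in> carrier R" "v \<in> carrier R"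
    using assms uv by auto
  have "(u \<otimes> v) \<otimes> ((s' \<otimes> t') \<otimes> (a \<otimes> b)) = (u \<otimes> (s' \<otimes> a)) \<otimes> (v \<otimes> (t' \<otimes> b))"
    using c by (simp add: m_ac)
  also have "\<dots> = (u \<otimes> v) \<otimes> ((s \<otimes> t) \<otimes> (a' \<otimes> b'))"
    unfolding 1 2 using c by (simp add: m_ac)
  finally show ?thesis
    using loc_frac_eq_iff[of "a \<otimes> b" "s \<otimes> t" "a' \<otimes> b'" "s' \<otimes> t'"] assms(1-8)
      compl_mult[OF uv] compl_mult[of s t] compl_mult[of s' t'] c by blast
qed

lemma loc_frac_add_cong:
  assumes "a \<in> carrier R" "s \<in> carrier R - I" "a' \<in> carrier R" "s' \<in> carrier R - I"
    "b \<in> carrier R" "t \<in> carrier R - I" "b' \<in> carrier R" "t' \<in> carrier R - I"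
    "loc_frac R I a s = loc_frac R I a' s'" "loc_frac R I b t = loc_frac R I b' t'"
  shows "loc_frac R I (t \<otimes> a \<oplus> s \<otimes> b) (s \<otimes> t) = loc_frac R I (t' \<otimes> a' \<oplus> s' \<otimes> b') (s' \<otimes> t')"
proof -
  obtain u v where uv: "u \<in> carrier R - I" "v \<in> carrier R - I"
    and 1: "u \<otimes> (s' \<otimes> a) = u \<otimes> (s \<otimes> a')" and 2: "v \<otimes> (t' \<otimes> b) = v \<otimes> (t \<otimes> b')"
    using assms(9,10) loc_frac_eq_iff[OF assms(1-4)] loc_frac_eq_iff[OF assms(5-8)] by blast
  have c: "a \<in> carrier R" "s \<in> carrier R" "a' \<in> carrier R" "s' \<in> carrier R" "b \<in> carrier R"
    "t \<in> carrier R" "b' \<in> carrier R" "t' \<in> carrier R" "u \<in> carrier R" "v \<in> carrier R"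
    using assms uv by auto
  have "(u \<otimes> v) \<otimes> ((s' \<otimes> t') \<otimes> (t \<otimes> a \<oplus> s \<otimes> b)) =
      (v \<otimes> t' \<otimes> t) \<otimes> (u \<otimes> (s' \<otimes> a)) \<oplus> (u \<otimes> s' \<otimes> s) \<otimes> (v \<otimes> (t' \<otimes> b))"
    using c by (simp add: r_distr m_ac)
  also have "\<dots> = (u \<otimes> v) \<otimes> ((s \<otimes> t) \<otimes> (t' \<otimes> a' \<oplus> s' \<otimes> b'))"
    unfolding 1 2 using c by (simp add: r_distr m_ac)
  finally show ?thesis
    using loc_frac_eq_iff[of "t \<otimes> a \<oplus> s \<otimes> b" "s \<otimes> t" "t' \<otimes> a' \<oplus> s' \<otimes> b'" "s' \<otimes> t'"] assms(1-8)
      compl_mult[OF uv] compl_mult[of s t] compl_mult[of s' t'] c by blast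
qed

lemma localization_mult:
  assumes "a \<in> carrier R" "s \<in> carrier R - I" "b \<in> carrier R" "t \<in> carrier R - I"
  shows "loc_frac R I a s \<otimes>\<^bsub>localization R I\<^esub> loc_frac R I b t = loc_frac R I (a \<otimes> b) (s \<otimes> t)"
proof -
  have "loc_frac R I (a' \<otimes> b') (s' \<otimes> t') = loc_frac R I (a \<otimes> b) (s \<otimes> t)"
    if "(a', s') \<in> loc_frac R I a s" "(b', t') \<in> loc_frac R I b t" for a' s' b' t'
    using loc_frac_mult_cong[OF assms(1,2) _ _ assms(3,4)] loc_frac_eqD[OF that(1) assms(1,2)]
      loc_frac_eqD[OF that(2) assms(3,4)] by simp
  from UN_pairs_const[OF loc_frac_refl[OF assms(1,2)] loc_frac_refl[OF assms(3,4)] this]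
  show ?thesis by (simp add: localization_def)
qed

lemma localization_add:
  assumes "a \<in> carrier R" "s \<in> carrier R - I" "b \<in> carrier R" "t \<in> carrier R - I"
  shows "loc_frac R I a s \<oplus>\<^bsub>localization R I\<^esub> loc_frac R I b t =
    loc_frac R I (t \<otimes> a \<oplus> s \<otimes> b) (s \<otimes> t)"
proof -
  have "loc_frac R I (t' \<otimes> a' \<oplus> s' \<otimes> b') (s' \<otimes> t') = loc_frac R I (t \<otimes> a \<oplus> s \<otimes> b) (s \<otimes> t)"
    if "(a', s') \<in> loc_frac R I a s" "(b', t') \<in> loc_frac R I b t" for a' s' b' t'
    using loc_frac_add_cong[OF assms(1,2) _ _ assms(3,4)] loc_frac_eqD[OF that(1) assms(1,2)]
      loc_frac_eqD[OF that(2) assms(3,4)] by simp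
  from UN_pairs_const[OF loc_frac_refl[OF assms(1,2)] loc_frac_refl[OF assms(3,4)] this]
  show ?thesis by (simp add: localization_def)
qed

lemma localization_carrierE:
  assumes "X \<in> carrier (localization R I)"
  obtains a s where "a \<in> carrier R" "s \<in> carrier R" "s \<notin> I" "X = loc_frac R I a s"
  using assms by (auto simp: localization_def)

lemma localization_carrierI:
  "a \<in> carrier R \<Longrightarrow> s \<in> carrier R - I \<Longrightarrow> loc_frac R I a s \<in> carrier (localization R I)"
  by (auto simp: localization_def)

lemma localization_one: "\<one>\<^bsub>localization R I\<^esub> = loc_frac R I \<one> \<one>"
  and localization_zero: "\<zero>\<^bsub>localization R I\<^esub> = loc_frac R I \<zero> \<one>"
  by (simp_all add: localization_def)

lemma loc_frac_eqI:
  assumes "a \<in> carrier R" "s \<in> carrier R - I" "b \<in> carrier R" "t \<in> carrier R - I"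
    "t \<otimes> a = s \<otimes> b"
  shows "loc_frac R I a s = loc_frac R I b t"
  using assms(5) loc_frac_eq_iff[OF assms(1-4)] compl_one by auto

lemma localization_cring: "cring (localization R I)" (is "cring ?L")
proof -
  have c: "s \<otimes> t \<notin> I" if "s \<in> carrier R" "s \<notin> I" "t \<in> carrier R" "t \<notin> I" for s t
    using that compl_mult by auto
  have c1: "\<one> \<notin> I" using compl_one by simp
  note L = localization_mult localization_add localization_one localization_zero
    localization_carrierI c c1
  note E = localization_carrierE
  show ?thesis
  proof (rule cringI)
    show "abelian_group ?L"
    proof (rule abelian_groupI)
      fix X Y assume "X \<in> carrier ?L" "Y \<in> carrier ?L"
      then show "X \<oplus>\<^bsub>?L\<^esub> Y \<in> carrier ?L" by (elim E) (simp add: L)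
    next
      show "\<zero>\<^bsub>?L\<^esub> \<in> carrier ?L" by (simp add: L)
    next
      fix X Y Z assume "X \<in> carrier ?L" "Y \<in> carrier ?L" "Z \<in> carrier ?L"
      then show "X \<oplus>\<^bsub>?L\<^esub> Y \<oplus>\<^bsub>?L\<^esub> Z = X \<oplus>\<^bsub>?L\<^esub> (Y \<oplus>\<^bsub>?L\<^esub> Z)"
        by (elim E) (simp add: L r_distr m_ac a_ac)
    next
      fix X Y assume "X \<in> carrier ?L" "Y \<in> carrier ?L"
      then show "X \<oplus>\<^bsub>?L\<^esub> Y = Y \<oplus>\<^bsub>?L\<^esub> X"
        by (elim E) (simp add: L m_ac a_ac)
    next
      fix X assume "X \<in> carrier ?L"
      then show "\<zero>\<^bsub>?L\<^esub> \<oplus>\<^bsub>?L\<^esub> X = X" by (elim E) (simp add: L)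
    next
      fix X assume "X \<in> carrier ?L"
      then obtain a s where X: "a \<in> carrier R" "s \<in> carrier R" "s \<notin> I" "X = loc_frac R I a s"
        by (rule E)
      have "loc_frac R I (\<ominus> a) s \<oplus>\<^bsub>?L\<^esub> X = loc_frac R I \<zero> (s \<otimes> s)"
        using X by (simp add: L r_minus l_neg)
      also have "\<dots> = \<zero>\<^bsub>?L\<^esub>"
        unfolding localization_zero using X by (intro loc_frac_eqI) (simp_all add: L)
      finally show "\<exists>Y\<in>carrier ?L. Y \<oplus>\<^bsub>?L\<^esub> X = \<zero>\<^bsub>?L\<^esub>"
        using X localization_carrierI[of "\<ominus> a" s] by blast
    qed
    show "Group.comm_monoid ?L"
    proof (rule comm_monoidI)
      fix X Y assume "X \<in> carrier ?L" "Y \<in> carrier ?L"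
      then show "X \<otimes>\<^bsub>?L\<^esub> Y \<in> carrier ?L" by (elim E) (simp add: L)
    next
      show "\<one>\<^bsub>?L\<^esub> \<in> carrier ?L" by (simp add: L)
    next
      fix X Y Z assume "X \<in> carrier ?L" "Y \<in> carrier ?L" "Z \<in> carrier ?L"
      then show "X \<otimes>\<^bsub>?L\<^esub> Y \<otimes>\<^bsub>?L\<^esub> Z = X \<otimes>\<^bsub>?L\<^esub> (Y \<otimes>\<^bsub>?L\<^esub> Z)"
        by (elim E) (simp add: L m_ac)
    next
      fix X assume "X \<in> carrier ?L"
      then show "\<one>\<^bsub>?L\<^esub> \<otimes>\<^bsub>?L\<^esub> X = X" by (elim E) (simp add: L)
    next
      fix X Y assume "X \<in> carrier ?L" "Y \<in> carrier ?L"
      then show "X \<otimes>\<^bsub>?L\<^esub> Y = Y \<otimes>\<^bsub>?L\<^esub> X" by (elim E) (simp add: L m_ac)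
    qed
  next
    fix X Y Z assume "X \<in> carrier ?L" "Y \<in> carrier ?L" "Z \<in> carrier ?L"
    then obtain a s b t d r where
      X: "a \<in> carrier R" "s \<in> carrier R" "s \<notin> I" "b \<in> carrier R" "t \<in> carrier R" "t \<notin> I"
        "d \<in> carrier R" "r \<in> carrier R" "r \<notin> I"
        "X = loc_frac R I a s" "Y = loc_frac R I b t" "Z = loc_frac R I d r"
      by (elim E) blast
    show "(X \<oplus>\<^bsub>?L\<^esub> Y) \<otimes>\<^bsub>?L\<^esub> Z = X \<otimes>\<^bsub>?L\<^esub> Z \<oplus>\<^bsub>?L\<^esub> Y \<otimes>\<^bsub>?L\<^esub> Z"
      using X by (simp add: L) (intro loc_frac_eqI; simp add: L l_distr r_distr m_ac)
  qed
qed

lemma localization_map_hom: "localization_map R I \<in> ring_hom R (localization R I)"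
  using compl_one
  by (auto intro!: ring_hom_memI
      simp: localization_map_def localization_carrierI localization_mult localization_add
        localization_one)

lemma localization_map_kernel:
  "a_kernel R (localization R I) (localization_map R I) =
     {a \<in> carrier R. \<exists>s \<in> carrier R - I. s \<otimes> a = \<zero>}"
proof -
  have "loc_frac R I a \<one> = loc_frac R I \<zero> \<one> \<longleftrightarrow> (\<exists>s \<in> carrier R - I. s \<otimes> a = \<zero>)"
    if "a \<in> carrier R" for a
    using loc_frac_eq_iff[OF that compl_one zero_closed compl_one] that by auto
  then show ?thesis
    by (auto simp only: a_kernel_def' localization_map_def localization_zero)
qed

end

end

theory Submission
  imports Defs "HOL-Algebra.Ring_Divisibility"
begin

text \<open>
  Two facts on prime ideals carry the argument. If no power of \<open>a\<close> is annihilated by an element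
  outside a prime \<open>P\<close>, then some minimal prime inside \<open>P\<close> avoids \<open>a\<close>, since the multiplicative set
  generated by \<open>a\<close> and the complement of \<open>P\<close> does not contain \<open>\<zero>\<close>. And if \<open>Ann(a\<^sup>n) + Ann(b\<^sup>n)\<close> is
  proper for all \<open>n\<close>, then so is the increasing union of these ideals, which therefore lies in a
  prime \<open>P\<close>. For \<open>ab = \<zero>\<close> in an mp-ring the unique minimal prime inside \<open>P\<close> would avoid both \<open>a\<close>
  and \<open>b\<close>. Conversely, if \<open>sa = \<zero>\<close> with \<open>s\<close> outside \<open>P\<close>, a decomposition \<open>\<one> = r + t\<close> in
  \<open>Ann(s\<^sup>n) + Ann(a\<^sup>n)\<close> makes \<open>r\<close> a witness of N-purity at \<open>a\<close> for the kernel of localization at \<open>P\<close>.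
\<close>

section \<open>Prime and minimal prime ideals missing a multiplicative set\<close>

lemma (in cring) cring_idealI:
  assumes "I \<subseteq> carrier R" "\<zero> \<in> I"
    and add: "\<And>x y. x \<in> I \<Longrightarrow> y \<in> I \<Longrightarrow> x \<oplus> y \<in> I"
    and mult: "\<And>x r. x \<in> I \<Longrightarrow> r \<in> carrier R \<Longrightarrow> r \<otimes> x \<in> I"
  shows "ideal I R"
proof (rule idealI[OF ring_axioms])
  show "subgroup I (add_monoid R)"
  proof
    \<comment> \<open>Negation is scaling by \<open>\<ominus> \<one>\<close>, so closure under
      multiples already covers additive inverses.\<close>
    fix x assume "x \<in> I"
    moreover from this have "\<ominus> x = (\<ominus> \<one>) \<otimes> x" using assms(1) by (auto simp: l_minus)
    ultimately show "inv\<^bsub>add_monoid R\<^esub> x \<in> I"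
      using mult[of x "\<ominus> \<one>"] by (simp add: a_inv_def)
  qed (use assms in auto)
  show "x \<otimes> a \<in> I" if "a \<in> I" "x \<in> carrier R" for a x
    using mult that .
  then show "a \<otimes> x \<in> I" if "a \<in> I" "x \<in> carrier R" for a x
    using that assms(1) m_comm[of a x] by auto
qed

lemma (in primeideal) compl_submonoid: "submonoid (carrier R - I) R"
  using compl_mult compl_one by (intro submonoid.intro) auto

text \<open>Krull's argument: an ideal maximal among those containing \<open>I\<close> and missing
  \<open>S\<close> is prime. If neither factor of a product in it belonged to it, both enlarged
  ideals would meet \<open>S\<close>, and multiplying the two meeting points would give an element
  of \<open>S\<close> inside the maximal ideal.\<close>

lemma (in cring) exists_primeideal_disjoint:
  assumes I: "ideal I R" and S: "submonoid S R" and disj: "I \<inter> S = {}"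
  obtains P where "primeideal P R" "I \<subseteq> P" "P \<inter> S = {}"
proof -
  interpret S: submonoid S R by (rule S)
  let ?A = "{J. ideal J R \<and> I \<subseteq> J \<and> J \<inter> S = {}}"
  have "\<exists>M\<in>?A. \<forall>X\<in>?A. M \<subseteq> X \<longrightarrow> X = M"
  proof (rule subset_Zorn_nonempty)
    show "?A \<noteq> {}" using I disj by blast
  next
    fix C assume C: "C \<noteq> {}" "subset.chain ?A C"
    then have sub: "C \<subseteq> ?A" by (simp add: subset_chain_def)
    have "subset.chain {J. ideal J R} C" using C(2) by (auto simp: subset_chain_def)
    from chain_Union_is_ideal[OF this] C(1) have "ideal (\<Union>C) R" by simp
    then show "\<Union>C \<in> ?A" using sub C(1) by blast
  qed
  then obtain M where "M \<in> ?A" and maxA: "\<forall>X\<in>?A. M \<subseteq> X \<longrightarrow> X = M" ..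
  then have M: "ideal M R" "I \<subseteq> M" "M \<inter> S = {}" by simp_all
  have max: "X = M" if "ideal X R" "I \<subseteq> X" "X \<inter> S = {}" "M \<subseteq> X" for X
    using maxA that by simp
  interpret M: ideal M R by (rule M(1))
  \<comment> \<open>Adjoining \<open>a\<close> enlarges \<open>M\<close> strictly, so by maximality
    the sum of \<open>M\<close> and the principal ideal of \<open>a\<close> can no longer miss
    \<open>S\<close>.\<close>
  have meets: "\<exists>m\<in>M. \<exists>r\<in>carrier R. m \<oplus> r \<otimes> a \<in> S" if a: "a \<in> carrier R" "a \<notin> M" for a
  proof -
    let ?J = "M <+>\<^bsub>R\<^esub> PIdl a"
    have J: "ideal ?J R" using add_ideals[OF M(1) cgenideal_ideal[OF a(1)]] .
    have "M \<subseteq> ?J"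
    proof
      fix m assume "m \<in> M"
      moreover have "m = m \<oplus> \<zero> \<otimes> a" using \<open>m \<in> M\<close> a(1) by simp
      ultimately show "m \<in> ?J" unfolding set_add_def' cgenideal_def by blast
    qed
    moreover have "a \<in> ?J"
    proof -
      have "a = \<zero> \<oplus> \<one> \<otimes> a" using a(1) by simp
      then show ?thesis unfolding set_add_def' cgenideal_def using M.zero_closed by blast
    qed
    ultimately have "?J \<inter> S \<noteq> {}" using max[OF J] M(2) a(2) by blast
    then show ?thesis unfolding set_add_def' cgenideal_def by auto
  qed
  have "primeideal M R"
  proof (rule primeidealI[OF M(1) cring_axioms])
    show "carrier R \<noteq> M" using M(3) S.one_closed by auto
  next
    fix a b assume ab: "a \<in> carrier R" "b \<in> carrier R" "a \<otimes> b \<in> M"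
    show "a \<in> M \<or> b \<in> M"
    proof (rule ccontr)
      assume "\<not> (a \<in> M \<or> b \<in> M)"
      then obtain m r m' r' where mr: "m \<in> M" "r \<in> carrier R" "m \<oplus> r \<otimes> a \<in> S"
        "m' \<in> M" "r' \<in> carrier R" "m' \<oplus> r' \<otimes> b \<in> S"
        using meets ab by metis
      have c: "m \<in> carrier R" "m' \<in> carrier R" using mr M.a_subset by auto
      \<comment> \<open>The product is regrouped into multiples of \<open>m\<close>,
        \<open>m'\<close> and \<open>a \<otimes> b\<close>, all of which lie in
        \<open>M\<close>.\<close>
      have "(m \<oplus> r \<otimes> a) \<otimes> (m' \<oplus> r' \<otimes> b) =
          (m' \<oplus> r' \<otimes> b) \<otimes> m \<oplus> ((r \<otimes> a) \<otimes> m' \<oplus> (r \<otimes> r') \<otimes> (a \<otimes> b))"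
        using c mr ab by (simp add: l_distr r_distr m_ac a_ac)
      also have "\<dots> \<in> M"
        using M.I_l_closed[OF mr(1), of "m' \<oplus> r' \<otimes> b"] M.I_l_closed[OF mr(4), of "r \<otimes> a"]
          M.I_l_closed[OF ab(3), of "r \<otimes> r'"] c mr ab by (intro M.a_closed) simp_all
      finally show False using S.m_closed[OF mr(3,6)] M(3) by blast
    qed
  qed
  then show thesis using that M by blast
qed

text \<open>Zorn is applied to submonoids rather than to primes. Let \<open>T\<close> be maximal
  among the submonoids containing \<open>S\<close> but not \<open>\<zero>\<close>. The complement of
  any prime missing \<open>T\<close> is again such a submonoid, hence equals \<open>T\<close>. A
  prime below a prime missing \<open>T\<close> also misses \<open>T\<close>, so the two have the
  same complement and coincide.\<close>

lemma (in cring) exists_minimal_primeideal_disjoint: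
  assumes S: "submonoid S R" and "\<zero> \<notin> S"
  obtains Q where "minimal_primeideal Q R" "Q \<inter> S = {}"
proof -
  let ?A = "{T. submonoid T R \<and> S \<subseteq> T \<and> \<zero> \<notin> T}"
  have "\<exists>M\<in>?A. \<forall>X\<in>?A. M \<subseteq> X \<longrightarrow> X = M"
  proof (rule subset_Zorn_nonempty)
    show "?A \<noteq> {}" using assms by blast
  next
    fix C assume C: "C \<noteq> {}" "subset.chain ?A C"
    then have sub: "C \<subseteq> ?A" and ch: "\<And>X Y. X \<in> C \<Longrightarrow> Y \<in> C \<Longrightarrow> X \<subseteq> Y \<or> Y \<subseteq> X"
      by (auto simp: subset_chain_def)
    have "submonoid (\<Union>C) R"
    proof (rule submonoid.intro)
      show "\<Union>C \<subseteq> carrier R" using sub submonoid.subset by blast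
      show "\<one> \<in> \<Union>C" using sub C(1) submonoid.one_closed by blast
    next
      fix x y assume "x \<in> \<Union>C" "y \<in> \<Union>C"
      then obtain T where "T \<in> C" "x \<in> T" "y \<in> T" using ch by blast
      then show "x \<otimes> y \<in> \<Union>C" using sub submonoid.m_closed[of T R x y] by blast
    qed
    then show "\<Union>C \<in> ?A" using sub C(1) by blast
  qed
  then obtain T where "T \<in> ?A" and maxA: "\<forall>X\<in>?A. T \<subseteq> X \<longrightarrow> X = T" ..
  then have T: "submonoid T R" "S \<subseteq> T" "\<zero> \<notin> T" by simp_all
  have max: "X = T" if "submonoid X R" "\<zero> \<notin> X" "T \<subseteq> X" for X
    using maxA that T(2) by simp
  have compl: "carrier R - Q = T" if Q: "primeideal Q R" "Q \<inter> T = {}" for Q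
  proof -
    interpret Q: primeideal Q R by (rule Q(1))
    show ?thesis
      using max[OF Q.compl_submonoid] Q(2) submonoid.subset[OF T(1)] by auto
  qed
  obtain Q where Q: "primeideal Q R" "Q \<inter> T = {}"
    using exists_primeideal_disjoint[OF zeroideal T(1)] T(3) by auto
  have "Q' = Q" if "primeideal Q' R" "Q' \<subseteq> Q" for Q'
  proof -
    have "Q' \<subseteq> carrier R" "Q \<subseteq> carrier R"
      using that(1) Q(1)
      by (meson additive_subgroup.a_subset ideal.axioms(1) primeideal.axioms(1))+
    moreover have "carrier R - Q' = carrier R - Q"
      using compl[OF Q] compl[OF that(1)] that(2) Q(2) by blast
    ultimately show ?thesis by blast
  qed
  then have "minimal_primeideal Q R" unfolding minimal_primeideal_def using Q(1) by blast
  then show thesis using that Q(2) T(2) by blast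
qed

section \<open>Nilpotent elements and minimal primes inside a given prime\<close>

lemma (in primeideal) pow_mem_imp_mem:
  "a \<in> carrier R \<Longrightarrow> a [^] (n::nat) \<in> I \<Longrightarrow> a \<in> I"
proof (induction n)
  case 0
  then show ?case using compl_one by simp
next
  case (Suc n)
  then show ?case using I_prime[of "a [^] n" a] by auto
qed

lemma (in primeideal) nilradical_subset: "nilradical R \<subseteq> I"
proof
  fix x assume "x \<in> nilradical R"
  then obtain n :: nat where "x \<in> carrier R" "x [^] n = \<zero>" by (auto simp: nilradical_def)
  then show "x \<in> I" using pow_mem_imp_mem[of x n] by simp
qed

lemma (in primeideal) obtains_minimal_primeideal:
  obtains Q where "minimal_primeideal Q R" "Q \<subseteq> I"
proof -
  have "\<zero> \<notin> carrier R - I" by simp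
  from exists_minimal_primeideal_disjoint[OF compl_submonoid this]
  obtain Q where Q: "minimal_primeideal Q R" "Q \<inter> (carrier R - I) = {}" .
  have "Q \<subseteq> carrier R"
    using Q(1) unfolding minimal_primeideal_def
    by (meson additive_subgroup.a_subset ideal.axioms(1) primeideal.axioms(1))
  then show thesis using that Q by blast
qed

lemma (in primeideal) minimal_primeideal_avoiding:
  assumes a: "a \<in> carrier R"
    and nz: "\<And>s n. s \<in> carrier R - I \<Longrightarrow> s \<otimes> a [^] (n::nat) \<noteq> \<zero>"
  obtains Q where "minimal_primeideal Q R" "Q \<subseteq> I" "a \<notin> Q"
proof -
  let ?S = "{s \<otimes> a [^] n |s n::nat. s \<in> carrier R - I}"
  have S: "submonoid ?S R"
  proof (rule submonoid.intro)
    show "?S \<subseteq> carrier R" using a by auto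
    have "\<one> = \<one> \<otimes> a [^] (0::nat)" by simp
    then show "\<one> \<in> ?S" using compl_one by blast
  next
    fix x y assume "x \<in> ?S" "y \<in> ?S"
    then obtain s m t n where xy: "x = s \<otimes> a [^] (m::nat)" "s \<in> carrier R - I"
      "y = t \<otimes> a [^] (n::nat)" "t \<in> carrier R - I" by blast
    then have "x \<otimes> y = (s \<otimes> t) \<otimes> a [^] (m + n)"
      using a by (simp add: m_ac flip: nat_pow_mult)
    then show "x \<otimes> y \<in> ?S" using compl_mult xy by blast
  qed
  have "\<zero> \<notin> ?S"
  proof
    assume "\<zero> \<in> ?S"
    then obtain s and n :: nat where "\<zero> = s \<otimes> a [^] n" "s \<in> carrier R - I" by blast
    then show False using nz[of s n] by simp
  qed
  from exists_minimal_primeideal_disjoint[OF S this]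
  obtain Q where Q: "minimal_primeideal Q R" "Q \<inter> ?S = {}" .
  have sub: "Q \<subseteq> carrier R"
    using Q(1) unfolding minimal_primeideal_def
    by (meson additive_subgroup.a_subset ideal.axioms(1) primeideal.axioms(1))
  \<comment> \<open>Exponent 0 puts the whole complement of \<open>I\<close> into \<open>?S\<close>,
    which forces \<open>Q \<subseteq> I\<close>; exponent 1 with \<open>s = \<one>\<close> puts
    \<open>a\<close> itself there, which forces \<open>a \<notin> Q\<close>.\<close>
  have "s \<in> ?S" if "s \<in> carrier R - I" for s
  proof -
    have "s = s \<otimes> a [^] (0::nat)" using that by simp
    then show ?thesis using that by blast
  qed
  then have "Q \<subseteq> I" using Q(2) sub by blast
  moreover have "a = \<one> \<otimes> a [^] (1::nat)" using a by simp
  then have "a \<in> ?S" using compl_one by blast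
  then have "a \<notin> Q" using Q(2) by blast
  ultimately show thesis using that Q(1) by blast
qed

section \<open>Annihilators of powers\<close>

lemma (in cring) Ann_ideal:
  assumes "a \<in> carrier R"
  shows "ideal (Ann R a) R"
  using assms by (intro cring_idealI) (auto simp: Ann_def l_distr m_assoc)

lemma (in cring) Ann_pow_mono:
  assumes "a \<in> carrier R" "m \<le> (n::nat)"
  shows "Ann R (a [^] m) \<subseteq> Ann R (a [^] n)"
proof
  fix r assume r: "r \<in> Ann R (a [^] m)"
  have "a [^] n = a [^] m \<otimes> a [^] (n - m)" using assms by (simp add: nat_pow_mult)
  then show "r \<in> Ann R (a [^] n)"
    using r assms(1) by (simp add: Ann_def flip: m_assoc)
qed

lemma (in cring) UN_Ann_pow_ideal:
  assumes "a \<in> carrier R"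
  shows "ideal (\<Union>n::nat. Ann R (a [^] n)) R"
proof (rule cring_idealI)
  fix x y assume "x \<in> (\<Union>n::nat. Ann R (a [^] n))" "y \<in> (\<Union>n::nat. Ann R (a [^] n))"
  then obtain m n where mn: "x \<in> Ann R (a [^] (m::nat))" "y \<in> Ann R (a [^] (n::nat))" by blast
  \<comment> \<open>The annihilators grow with the exponent, so the larger one contains both
    summands.\<close>
  interpret ideal "Ann R (a [^] max m n)" R using assms by (intro Ann_ideal) simp
  have "x \<oplus> y \<in> Ann R (a [^] max m n)"
    using mn Ann_pow_mono[OF assms, of m "max m n"] Ann_pow_mono[OF assms, of n "max m n"]
    by (intro a_closed) auto
  then show "x \<oplus> y \<in> (\<Union>n::nat. Ann R (a [^] n))" by blast
next
  fix x r assume "x \<in> (\<Union>n::nat. Ann R (a [^] n))" and r: "r \<in> carrier R"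
  then obtain n where "x \<in> Ann R (a [^] (n::nat))" by blast
  then have "r \<otimes> x \<in> Ann R (a [^] n)" using assms r by (simp add: Ann_def m_assoc)
  then show "r \<otimes> x \<in> (\<Union>n::nat. Ann R (a [^] n))" by blast
qed (use assms in \<open>auto simp: Ann_def\<close>)

text \<open>
  The union of the ideals \<open>Ann(a\<^sup>n) + Ann(b\<^sup>n)\<close> over \<open>n\<close> is written as the sum of the two unions.
\<close>

lemma (in cring) mp_ring_imp_Ann_comaximal:
  assumes mp: "mp_ring R" and a: "a \<in> carrier R" and b: "b \<in> carrier R" and ab: "a \<otimes> b = \<zero>"
  shows "\<exists>n::nat. n \<ge> 1 \<and> Ann R (a [^] n) <+>\<^bsub>R\<^esub> Ann R (b [^] n) = carrier R"
proof -
  let ?A = "\<Union>n::nat. Ann R (a [^] n)" and ?B = "\<Union>n::nat. Ann R (b [^] n)"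
  have J: "ideal (?A <+>\<^bsub>R\<^esub> ?B) R"
    using add_ideals[OF UN_Ann_pow_ideal[OF a] UN_Ann_pow_ideal[OF b]] .
  have "\<one> \<in> ?A <+>\<^bsub>R\<^esub> ?B"
  proof (rule ccontr)
    assume "\<one> \<notin> ?A <+>\<^bsub>R\<^esub> ?B"
    \<comment> \<open>Missing the trivial submonoid means being proper, so the disjointness lemma
      yields a prime above a proper ideal.\<close>
    moreover have "submonoid {\<one>} R" by (rule submonoid.intro) auto
    ultimately obtain P where P: "primeideal P R" "?A <+>\<^bsub>R\<^esub> ?B \<subseteq> P"
      using exists_primeideal_disjoint[OF J] by blast
    interpret P: primeideal P R by (rule P(1))
    have PA: "?A \<subseteq> P"
    proof
      fix x assume x: "x \<in> ?A"
      then have "x = x \<oplus> \<zero>" by (auto simp: Ann_def)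
      moreover have "\<zero> \<in> ?B" using b by (auto simp: Ann_def)
      ultimately show "x \<in> P" using x P(2) unfolding set_add_def' by blast
    qed
    have PB: "?B \<subseteq> P"
    proof
      fix x assume x: "x \<in> ?B"
      then have "x = \<zero> \<oplus> x" by (auto simp: Ann_def)
      moreover have "\<zero> \<in> ?A" using a by (auto simp: Ann_def)
      ultimately show "x \<in> P" using x P(2) unfolding set_add_def' by blast
    qed
    \<comment> \<open>An element killing a power of \<open>a\<close> lies in \<open>?A\<close>,
      hence in \<open>P\<close>.\<close>
    have nzA: "s \<otimes> a [^] n \<noteq> \<zero>" if "s \<in> carrier R - P" for s and n :: nat
      using PA that by (auto simp: Ann_def)
    have nzB: "s \<otimes> b [^] n \<noteq> \<zero>" if "s \<in> carrier R - P" for s and n :: nat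
      using PB that by (auto simp: Ann_def)
    obtain Q where Q: "minimal_primeideal Q R" "Q \<subseteq> P" "a \<notin> Q"
      using P.minimal_primeideal_avoiding[OF a nzA] .
    obtain Q' where Q': "minimal_primeideal Q' R" "Q' \<subseteq> P" "b \<notin> Q'"
      using P.minimal_primeideal_avoiding[OF b nzB] .
    have "Q' = Q" using mp P(1) Q Q' unfolding mp_ring_def by blast
    moreover interpret Q: primeideal Q R using Q(1) by (simp add: minimal_primeideal_def)
    have "a \<in> Q \<or> b \<in> Q" using Q.I_prime[OF a b] ab by simp
    ultimately show False using Q(3) Q'(3) by blast
  qed
  then obtain r t m n where rt: "r \<in> Ann R (a [^] (m::nat))" "t \<in> Ann R (b [^] (n::nat))"
    and sum: "r \<oplus> t = \<one>"
    unfolding set_add_def' by auto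
  \<comment> \<open>The maximum brings both annihilators to a common exponent; since
    \<open>m\<close> and \<open>n\<close> may both be 0, \<open>Suc\<close> secures a positive
    one.\<close>
  let ?k = "Suc (max m n)"
  interpret K: ideal "Ann R (a [^] ?k) <+>\<^bsub>R\<^esub> Ann R (b [^] ?k)" R
    using a b by (intro add_ideals Ann_ideal) auto
  have "m \<le> ?k" "n \<le> ?k" by simp_all
  then have "r \<in> Ann R (a [^] ?k)" "t \<in> Ann R (b [^] ?k)"
    using rt Ann_pow_mono[OF a, of m ?k] Ann_pow_mono[OF b, of n ?k] by blast+
  then have "\<one> \<in> Ann R (a [^] ?k) <+>\<^bsub>R\<^esub> Ann R (b [^] ?k)"
    unfolding set_add_def' using sum by force
  then have "Ann R (a [^] ?k) <+>\<^bsub>R\<^esub> Ann R (b [^] ?k) = carrier R"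
    by (rule K.one_imp_carrier)
  moreover have "?k \<ge> 1" by simp
  ultimately show ?thesis by blast
qed

section \<open>N-purity of localization kernels and of minimal primes\<close>

lemma (in primeideal) localization_map_kernel_ideal:
  "ideal (a_kernel R (localization R I) (localization_map R I)) R"
proof -
  interpret ring_hom_ring R "localization R I" "localization_map R I"
    using ring_axioms cring.axioms(1)[OF localization_cring] localization_map_hom
    by (rule ring_hom_ringI2)
  show ?thesis by (rule kernel_is_ideal)
qed

lemma (in primeideal) localization_map_kernel_subset:
  "a_kernel R (localization R I) (localization_map R I) \<subseteq> I"
proof -
  have "a \<in> I" if "a \<in> carrier R" "s \<in> carrier R - I" "s \<otimes> a = \<zero>" for a s
    using that I_prime[of s a] by auto
  then show ?thesis unfolding localization_map_kernel by blast
qed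

lemma (in cring) Ann_comaximal_imp_kernel_N_pure:
  assumes comax: "\<And>a b. a \<in> carrier R \<Longrightarrow> b \<in> carrier R \<Longrightarrow> a \<otimes> b = \<zero> \<Longrightarrow>
      \<exists>n::nat. n \<ge> 1 \<and> Ann R (a [^] n) <+>\<^bsub>R\<^esub> Ann R (b [^] n) = carrier R"
    and "primeideal P R"
  shows "N_pure_ideal (a_kernel R (localization R P) (localization_map R P)) R"
proof -
  interpret P: primeideal P R by fact
  let ?K = "a_kernel R (localization R P) (localization_map R P)"
  have "\<exists>r\<in>?K. a \<otimes> (\<one> \<ominus> r) \<in> nilradical R" if aK: "a \<in> ?K" for a
  proof -
    obtain s where s: "a \<in> carrier R" "s \<in> carrier R" "s \<notin> P" "s \<otimes> a = \<zero>"
      using aK unfolding P.localization_map_kernel by blast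
    obtain n :: nat where "Ann R (s [^] n) <+>\<^bsub>R\<^esub> Ann R (a [^] n) = carrier R"
      using comax[OF s(2,1,4)] by blast
    then have "\<one> \<in> Ann R (s [^] n) <+>\<^bsub>R\<^esub> Ann R (a [^] n)" by simp
    then obtain r t where rt: "r \<in> carrier R" "t \<in> carrier R" "r \<otimes> s [^] n = \<zero>"
      "t \<otimes> a [^] n = \<zero>" and sum: "\<one> = r \<oplus> t"
      unfolding set_add_def' Ann_def by auto
    \<comment> \<open>This power is the element outside \<open>P\<close> that kills \<open>r\<close>
      and so places \<open>r\<close> in the kernel.\<close>
    have "s [^] n \<in> carrier R - P" using s P.pow_mem_imp_mem[of s n] by auto
    moreover have "s [^] n \<otimes> r = \<zero>" using rt s by (simp add: m_comm)
    ultimately have "r \<in> ?K" unfolding P.localization_map_kernel using rt by blast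
    moreover have "\<one> \<ominus> r = t"
      unfolding sum using rt by (simp add: a_minus_def a_comm[of r t] a_assoc r_neg)
    \<comment> \<open>The extra factor beyond the exponent \<open>n\<close> supplies a separate
      \<open>t\<close>, which pairs with \<open>a [^] n\<close> to give
      \<open>\<zero>\<close>.\<close>
    moreover have "(a \<otimes> t) [^] Suc n = \<zero>"
    proof -
      have "(a \<otimes> t) [^] Suc n = (a [^] n \<otimes> t [^] n) \<otimes> (a \<otimes> t)"
        using s rt by (simp add: nat_pow_distrib)
      also have "\<dots> = (t \<otimes> a [^] n) \<otimes> (t [^] n \<otimes> a)" using s(1) rt(2) by (simp add: m_ac)
      also have "\<dots> = \<zero>" using s rt by simp
      finally show ?thesis .
    qed
    then have "a \<otimes> t \<in> nilradical R" unfolding nilradical_def using s rt by blast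
    ultimately show ?thesis by auto
  qed
  then show ?thesis unfolding N_pure_ideal_def using P.localization_map_kernel_ideal by blast
qed

text \<open>By minimality, some power \<open>a [^] n\<close> of each \<open>a\<close> in
  \<open>P\<close> lies in the kernel. A witness \<open>b\<close> of N-purity at that power also
  serves \<open>a\<close>: with \<open>c = \<one> \<ominus> b\<close>, the power
  \<open>(a \<otimes> c) [^] Suc n\<close> is a multiple of the nilpotent
  \<open>a [^] n \<otimes> c\<close>.\<close>

lemma (in cring) kernel_N_pure_imp_minimal_primeideal_N_pure:
  assumes min: "minimal_primeideal P R"
    and pure: "N_pure_ideal (a_kernel R (localization R P) (localization_map R P)) R"
  shows "N_pure_ideal P R"
proof -
  interpret P: primeideal P R using min by (simp add: minimal_primeideal_def)
  let ?K = "a_kernel R (localization R P) (localization_map R P)"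
  have "\<exists>b\<in>P. a \<otimes> (\<one> \<ominus> b) \<in> nilradical R" if "a \<in> P" for a
  proof -
    have a: "a \<in> carrier R" using that by simp
    \<comment> \<open>Otherwise a minimal prime inside \<open>P\<close> would avoid
      \<open>a\<close>; minimality of \<open>P\<close> makes it equal to \<open>P\<close>, which
      contains \<open>a\<close>.\<close>
    obtain s and n :: nat where s: "s \<in> carrier R - P" "s \<otimes> a [^] n = \<zero>"
    proof (rule ccontr)
      assume "\<not> thesis"
      then have "\<And>s n. s \<in> carrier R - P \<Longrightarrow> s \<otimes> a [^] (n::nat) \<noteq> \<zero>" using that by blast
      then obtain Q where "minimal_primeideal Q R" "Q \<subseteq> P" "a \<notin> Q"
        using P.minimal_primeideal_avoiding[OF a] by blast
      then show False using min \<open>a \<in> P\<close> unfolding minimal_primeideal_def by blast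
    qed
    then have "a [^] n \<in> ?K" unfolding P.localization_map_kernel using a by auto
    then obtain b where b: "b \<in> ?K" and nil: "a [^] n \<otimes> (\<one> \<ominus> b) \<in> nilradical R"
      using pure unfolding N_pure_ideal_def by blast
    have bP: "b \<in> P" using b P.localization_map_kernel_subset by blast
    define c where "c = \<one> \<ominus> b"
    have c: "c \<in> carrier R" using bP by (simp add: c_def)
    obtain m :: nat where m: "(a [^] n \<otimes> c) [^] m = \<zero>"
      using nil unfolding nilradical_def c_def by blast
    have "(a \<otimes> c) [^] Suc n = (a [^] n \<otimes> c) \<otimes> (a \<otimes> c [^] n)"
      using a c by (simp add: nat_pow_distrib m_ac)
    then have "(a \<otimes> c) [^] (Suc n * m) = ((a [^] n \<otimes> c) \<otimes> (a \<otimes> c [^] n)) [^] m"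
      using a c nat_pow_pow[of "a \<otimes> c" "Suc n" m] by simp
    also have "\<dots> = (a [^] n \<otimes> c) [^] m \<otimes> (a \<otimes> c [^] n) [^] m"
      using a c by (intro nat_pow_distrib) auto
    also have "\<dots> = \<zero>" using a c m by simp
    finally have "a \<otimes> (\<one> \<ominus> b) \<in> nilradical R"
      unfolding nilradical_def c_def[symmetric] using a c by blast
    then show ?thesis using bP by blast
  qed
  then show ?thesis unfolding N_pure_ideal_def using P.is_ideal by blast
qed

text \<open>Take two minimal primes \<open>Q\<close> and \<open>Q'\<close> inside \<open>P\<close>.
  For \<open>a\<close> in \<open>Q\<close>, a witness \<open>b\<close> of N-purity lies in
  \<open>P\<close>, so \<open>\<one> \<ominus> b\<close> lies outside \<open>P\<close> and hence
  outside \<open>Q'\<close>. The nilpotent \<open>a \<otimes> (\<one> \<ominus> b)\<close> is in the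
  prime \<open>Q'\<close>, so \<open>a\<close> is too. Thus \<open>Q \<subseteq> Q'\<close>, and
  minimality gives equality.\<close>

lemma (in cring) minimal_primeideals_N_pure_imp_mp_ring:
  assumes pure: "\<And>P. minimal_primeideal P R \<Longrightarrow> N_pure_ideal P R"
  shows "mp_ring R"
proof -
  have unique: "Q' = Q" if P: "primeideal P R"
    and Q: "minimal_primeideal Q R" "Q \<subseteq> P" and Q': "minimal_primeideal Q' R" "Q' \<subseteq> P"
    for P Q Q'
  proof -
    interpret P: primeideal P R by (rule P)
    interpret Q: primeideal Q R using Q(1) by (simp add: minimal_primeideal_def)
    interpret Q': primeideal Q' R using Q'(1) by (simp add: minimal_primeideal_def)
    have "Q \<subseteq> Q'"
    proof
      fix a assume a: "a \<in> Q"
      then obtain b where b: "b \<in> Q" "a \<otimes> (\<one> \<ominus> b) \<in> nilradical R"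
        using pure[OF Q(1)] unfolding N_pure_ideal_def by blast
      have "\<one> \<ominus> b \<notin> P"
      proof
        assume "\<one> \<ominus> b \<in> P"
        then have "(\<one> \<ominus> b) \<oplus> b \<in> P" using b(1) Q(2) by (intro P.a_closed) auto
        moreover have "(\<one> \<ominus> b) \<oplus> b = \<one>"
          using b(1) by (simp add: a_minus_def a_assoc l_neg)
        ultimately show False using P.compl_one by simp
      qed
      then have "\<one> \<ominus> b \<notin> Q'" using Q'(2) by blast
      moreover have "a \<otimes> (\<one> \<ominus> b) \<in> Q'" using b(2) Q'.nilradical_subset by blast
      ultimately show "a \<in> Q'" using Q'.I_prime[of a "\<one> \<ominus> b"] a b(1) by auto
    qed
    then show ?thesis using Q(1) Q'(1) unfolding minimal_primeideal_def by blast
  qed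
  have "\<exists>Q. minimal_primeideal Q R \<and> Q \<subseteq> P" if "primeideal P R" for P
    using primeideal.obtains_minimal_primeideal[OF that] by metis
  then show ?thesis unfolding mp_ring_def using cring_axioms unique by blast
qed

section \<open>The cycle of implications\<close>

theorem theorem3p3:
  fixes R :: "('a, 'b) ring_scheme" (structure)
  assumes "cring R"
  shows "(mp_ring R \<longleftrightarrow>
      (\<forall>a\<in>carrier R. \<forall>b\<in>carrier R. a \<otimes> b = \<zero> \<longrightarrow>
        (\<exists>n::nat. n \<ge> 1 \<and> Ann R (a [^] n) <+> Ann R (b [^] n) = carrier R)))
    \<and> (mp_ring R \<longleftrightarrow>
      (\<forall>P. minimal_primeideal P R \<longrightarrow> N_pure_ideal P R))
    \<and> (mp_ring R \<longleftrightarrow>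
      (\<forall>P. minimal_primeideal P R \<longrightarrow>
        N_pure_ideal (a_kernel R (localization R P) (localization_map R P)) R))
    \<and> (mp_ring R \<longleftrightarrow>
      (\<forall>P. primeideal P R \<longrightarrow>
        N_pure_ideal (a_kernel R (localization R P) (localization_map R P)) R))"
proof -
  interpret cring R by fact
  let ?ii = "\<forall>a\<in>carrier R. \<forall>b\<in>carrier R. a \<otimes> b = \<zero> \<longrightarrow>
    (\<exists>n::nat. n \<ge> 1 \<and> Ann R (a [^] n) <+>\<^bsub>R\<^esub> Ann R (b [^] n) = carrier R)"
  let ?iii = "\<forall>P. minimal_primeideal P R \<longrightarrow> N_pure_ideal P R"
  let ?iv = "\<forall>P. minimal_primeideal P R \<longrightarrow>
    N_pure_ideal (a_kernel R (localization R P) (localization_map R P)) R"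
  let ?v = "\<forall>P. primeideal P R \<longrightarrow>
    N_pure_ideal (a_kernel R (localization R P) (localization_map R P)) R"
  \<comment> \<open>The implications run through the cycle (i), (ii), (v), (iv), (iii), (i), the
    digits of each label naming its two ends. Every equivalence with (i) is then obtained by
    composing along the two arcs of the cycle.\<close>
  have 12: "?ii" if "mp_ring R"
    using mp_ring_imp_Ann_comaximal[OF that] by simp
  have 25: "?v" if ?ii
  proof (intro allI impI)
    fix P assume P: "primeideal P R"
    show "N_pure_ideal (a_kernel R (localization R P) (localization_map R P)) R"
      using that by (intro Ann_comaximal_imp_kernel_N_pure[OF _ P]) simp
  qed
  have 54: "?iv" if ?v using that by (simp add: minimal_primeideal_def)
  have 43: "?iii" if ?iv
    using that kernel_N_pure_imp_minimal_primeideal_N_pure by simp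
  have 31: "mp_ring R" if ?iii
    using that minimal_primeideals_N_pure_imp_mp_ring by simp
  note 51 = 31[OF 43[OF 54]]
  show ?thesis
    by (intro conjI iffI)
      (erule 12, erule 51[OF 25], erule 43[OF 54[OF 25[OF 12]]], erule 31,
        erule 54[OF 25[OF 12]], erule 31[OF 43], erule 25[OF 12], erule 51)
qed

end
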